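(* Let $r\geq 2$ be an integer, let $0<\alpha<(r+1)/(2r)$ be a constant, and let $m=m(n)=o(n)$. For all sufficiently large $n$ with $2r\mid n$, there exists a graph $G_\alpha$ with $v(G_\alpha)=n$ and $\delta(G_\alpha)\geq \alpha n$ such that $$h_r\big(G_\alpha\cup G(n,m)\big)=0$$ holds deterministically, that is, $h_r(G_\alpha\cup F)=0$ for every graph $F$ with $V(F)=V(G_\alpha)$ and $e(F)=m$.
   Context: $v(G)$, $e(G)$ and $\delta(G)$ denote the number of vertices, number of edges and minimum degree of $G$. $G(n,m)$ is the uniformly random graph with exactly $m$ edges on $V(G_\alpha)$; unions are unions of edge sets on the common vertex set. An $r$-colouring is an arbitrary map from the edge set to $[r]=\{1,\dots,r\}$. For a graph $G$ on $n$ vertices and an $r$-colouring $\chi$ of $E(G)$, the colour bias of a Hamilton cycle $H\subset G$ is the maximum over colours $c\in[r]$ of (number of edges of $H$ of colour $c$) $-\,n/r$. $h_r(G)$ is the minimum over all $r$-colourings $\chi$ of $E(G)$ of the maximum over all Hamilton cycles $H\subset G$ of the colour bias of $H$ in $\chi$, where the maximum over the empty set is taken to be $0$. Thus $h_r(G)=0$ means that there is an $r$-colouring of $E(G)$ in which every Hamilton cycle has the same number of edges of each colour. *)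

theory Defs
  imports Complex_Main "HOL-Library.FuncSet" "HOL-Library.Landau_Symbols"
begin

datatype 'a graph = Graph (verts: "'a set") (edges: "'a set set")

definition simple_graph :: "'a graph \<Rightarrow> bool" where
  "simple_graph G \<longleftrightarrow>
     finite (verts G) \<and> edges G \<subseteq> {e. e \<subseteq> verts G \<and> card e = 2}"

definition graph_union :: "'a graph \<Rightarrow> 'a graph \<Rightarrow> 'a graph" where
  "graph_union G F = Graph (verts G \<union> verts F) (edges G \<union> edges F)"

definition degree :: "'a graph \<Rightarrow> 'a \<Rightarrow> nat" where
  "degree G v = card {e \<in> edges G. v \<in> e}"

(* Min is unspecified on the empty set, so this is meaningful only if verts G is nonempty. *)
definition min_degree :: "'a graph \<Rightarrow> nat" where
  "min_degree G = Min (degree G ` verts G)"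

definition cycle_edges :: "'a list \<Rightarrow> 'a set set" where
  "cycle_edges vs = {{vs ! i, vs ! (Suc i mod length vs)} | i. i < length vs}"

(* A Hamilton cycle is identified with its edge set, so different traversals of
   the same cycle give the same element. *)
definition hamilton_cycles :: "'a graph \<Rightarrow> 'a set set set" where
  "hamilton_cycles G =
     {cycle_edges vs | vs. distinct vs \<and> length vs \<ge> 3 \<and> set vs = verts G \<and>
        cycle_edges vs \<subseteq> edges G}"

(* The extensional function space has one element for each map from the edge set
   to [r]; in particular it is finite for a finite graph. *)
definition colourings :: "nat \<Rightarrow> 'a graph \<Rightarrow> ('a set \<Rightarrow> nat) set" where
  "colourings r G = edges G \<rightarrow>\<^sub>E {1..r}"

definition colour_bias :: "nat \<Rightarrow> 'a graph \<Rightarrow> ('a set \<Rightarrow> nat) \<Rightarrow> 'a set set \<Rightarrow> real" where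
  "colour_bias r G \<chi> H =
     Max ((\<lambda>c. real (card {e \<in> H. \<chi> e = c}) - real (card (verts G)) / real r) ` {1..r})"

definition max_colour_bias :: "nat \<Rightarrow> 'a graph \<Rightarrow> ('a set \<Rightarrow> nat) \<Rightarrow> real" where
  "max_colour_bias r G \<chi> =
     (if hamilton_cycles G = {} then 0
      else Max (colour_bias r G \<chi> ` hamilton_cycles G))"

definition hamilton_bias :: "nat \<Rightarrow> 'a graph \<Rightarrow> real" where
  "hamilton_bias r G = Min (max_colour_bias r G ` colourings r G)"

end

theory Submission
  imports Defs
begin

text \<open>
  Write n = 2rt. Let G be the complete graph on n vertices with the edges inside a set I removed,
  where I has (r - 1)t + 2m vertices; as m = o(n), the minimum degree is at least \<alpha>n. The m
  edges of F meet at most 2m vertices, so (r - 1)t vertices of I remain independent after adding F.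
  Split them into r - 1 classes of size t, give the edges meeting the j-th class colour j, and
  all other edges colour r. A Hamilton cycle has two edges at each vertex and, by independence,
  no edge is counted twice, so it has exactly 2t = n/r edges of each of the first r - 1 colours, and
  hence of the last one. Conversely, by averaging, no Hamilton cycle ever has negative bias.
\<close>

section \<open>Edges of a cycle given by a list of vertices\<close>

lemma Suc_mod_cyclic:
  assumes "i < (n::nat)"
  shows "Suc i mod n = (if Suc i = n then 0 else Suc i)"
  using assms by (simp add: mod_Suc)

text \<open>If two positions gave the same pair, distinctness would make them equal or each the
  cyclic successor of the other, and the latter is impossible once the length is at least 3. This
  lets edges be counted by positions.\<close>

lemma cycle_edge_inj:
  assumes "distinct vs" "length vs \<ge> 3"
  shows "inj_on (\<lambda>i. {vs ! i, vs ! (Suc i mod length vs)}) {..<length vs}"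
proof (rule inj_onI)
  fix i j
  assume i: "i \<in> {..<length vs}" and j: "j \<in> {..<length vs}"
    and eq: "{vs ! i, vs ! (Suc i mod length vs)} = {vs ! j, vs ! (Suc j mod length vs)}"
  have lt: "Suc i mod length vs < length vs" "Suc j mod length vs < length vs"
    using i by (auto intro!: mod_less_divisor)
  from eq have "i = j \<or> (i = Suc j mod length vs \<and> Suc i mod length vs = j)"
    using i j lt assms(1) by (auto simp: doubleton_eq_iff nth_eq_iff_index_eq)
  then show "i = j"
    using i j assms(2) by (auto simp: Suc_mod_cyclic split: if_splits)
qed

lemma cycle_edges_image:
  "cycle_edges vs = (\<lambda>i. {vs ! i, vs ! (Suc i mod length vs)}) ` {..<length vs}"
  unfolding cycle_edges_def by auto

lemma finite_cycle_edges: "finite (cycle_edges vs)"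
  unfolding cycle_edges_image by simp

lemma card_cycle_edges:
  assumes "distinct vs" "length vs \<ge> 3"
  shows "card (cycle_edges vs) = length vs"
  unfolding cycle_edges_image using card_image[OF cycle_edge_inj[OF assms]] by simp

text \<open>The vertex at position \<open>j\<close> lies only on the edges that start at
  \<open>j\<close> and at its cyclic predecessor \<open>p\<close>, and injectivity makes these two
  edges different.\<close>

lemma card_cycle_edges_at_vertex:
  assumes "distinct vs" "length vs \<ge> 3" "v \<in> set vs"
  shows "card {e \<in> cycle_edges vs. v \<in> e} = 2"
proof -
  let ?n = "length vs"
  let ?E = "\<lambda>i. {vs ! i, vs ! (Suc i mod ?n)}"
  obtain j where j: "j < ?n" "v = vs ! j"
    using assms(3) by (auto simp: in_set_conv_nth)
  define p where "p = (if j = 0 then ?n - 1 else j - 1)"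
  have p: "p < ?n" "p \<noteq> j"
    using j assms(2) by (auto simp: p_def)
  have "v \<in> ?E i \<longleftrightarrow> i = j \<or> i = p" if "i < ?n" for i
  proof -
    have "Suc i mod ?n < ?n"
      using that by (intro mod_less_divisor) linarith
    then have "v \<in> ?E i \<longleftrightarrow> j = i \<or> j = Suc i mod ?n"
      using j that assms(1) by (auto simp: nth_eq_iff_index_eq)
    also have "\<dots> \<longleftrightarrow> i = j \<or> i = p"
      using that j by (auto simp: p_def Suc_mod_cyclic)
    finally show ?thesis .
  qed
  then have "{e \<in> cycle_edges vs. v \<in> e} = ?E ` {j, p}"
    unfolding cycle_edges_image using j(1) p(1) by blast
  also have "card \<dots> = card {j, p}"
    by (intro card_image inj_on_subset[OF cycle_edge_inj[OF assms(1,2)]]) (use j p in auto)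
  finally show ?thesis
    using p by simp
qed

text \<open>No edge of the cycle has both ends in \<open>S\<close>, so the edges at different
  vertices of \<open>S\<close> form disjoint sets, each of size 2.\<close>

lemma card_cycle_edges_meeting_independent:
  assumes "distinct vs" "length vs \<ge> 3" "S \<subseteq> set vs"
    and indep: "\<And>e. e \<in> cycle_edges vs \<Longrightarrow> card (e \<inter> S) \<le> 1"
  shows "card {e \<in> cycle_edges vs. e \<inter> S \<noteq> {}} = 2 * card S"
proof -
  let ?C = "\<lambda>v. {e \<in> cycle_edges vs. v \<in> e}"
  have fin: "finite S" "\<And>v. finite (?C v)"
    using finite_subset[OF assms(3)] finite_cycle_edges[of vs] by auto
  have "\<forall>v\<in>S. \<forall>w\<in>S. v \<noteq> w \<longrightarrow> ?C v \<inter> ?C w = {}"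
  proof (intro ballI impI)
    fix v w assume "v \<in> S" "w \<in> S" "v \<noteq> w"
    show "?C v \<inter> ?C w = {}"
    proof (rule ccontr)
      assume "?C v \<inter> ?C w \<noteq> {}"
      then obtain e where e: "e \<in> cycle_edges vs" "v \<in> e" "w \<in> e"
        by blast
      have "card {v, w} \<le> card (e \<inter> S)"
        using e \<open>v \<in> S\<close> \<open>w \<in> S\<close> fin(1) by (intro card_mono) auto
      then show False
        using indep[OF e(1)] \<open>v \<noteq> w\<close> by simp
    qed
  qed
  then have "card (\<Union>v\<in>S. ?C v) = (\<Sum>v\<in>S. card (?C v))"
    using fin by (intro card_UN_disjoint) auto
  also have "\<dots> = (\<Sum>v\<in>S. 2)"
    using assms(3) by (intro sum.cong refl card_cycle_edges_at_vertex[OF assms(1,2)]) auto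
  also have "(\<Union>v\<in>S. ?C v) = {e \<in> cycle_edges vs. e \<inter> S \<noteq> {}}"
    by blast
  finally show ?thesis
    by simp
qed

section \<open>Hamilton cycles and the sign of the colour bias\<close>

lemma hamilton_cyclesE:
  assumes "H \<in> hamilton_cycles G"
  obtains vs where "H = cycle_edges vs" "distinct vs" "length vs \<ge> 3" "set vs = verts G"
    "length vs = card (verts G)" "H \<subseteq> edges G"
  using assms unfolding hamilton_cycles_def by (auto simp: distinct_card[symmetric])

lemma finite_edges: "simple_graph G \<Longrightarrow> finite (edges G)"
  unfolding simple_graph_def by (rule finite_subset[of _ "Pow (verts G)"]) auto

lemma finite_hamilton_cycles:
  assumes "simple_graph G"
  shows "finite (hamilton_cycles G)"
proof (rule finite_subset)
  show "hamilton_cycles G \<subseteq> Pow (edges G)"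
    by (auto simp: hamilton_cycles_def)
  show "finite (Pow (edges G))"
    using finite_edges[OF assms] by simp
qed

lemma sum_card_colour_classes:
  fixes \<chi> :: "'a \<Rightarrow> nat"
  assumes "finite H" "\<chi> ` H \<subseteq> {1..r}"
  shows "(\<Sum>c\<in>{1..r}. card {e \<in> H. \<chi> e = c}) = card H"
  using sum.group[OF assms(1) finite_atLeastAtMost assms(2), of "\<lambda>_. 1::nat"] by simp

text \<open>A Hamilton cycle has as many edges as the graph has vertices, so the average size of a
  colour class on it is exactly the value subtracted in the bias. A negative bias would put every
  class below this average.\<close>

lemma colour_bias_nonneg:
  assumes "r \<ge> 1" "\<chi> \<in> colourings r G" "H \<in> hamilton_cycles G"
  shows "colour_bias r G \<chi> H \<ge> 0"
proof (rule ccontr)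
  let ?n = "real (card (verts G))"
  let ?k = "\<lambda>c. real (card {e \<in> H. \<chi> e = c})"
  assume neg: "\<not> colour_bias r G \<chi> H \<ge> 0"
  obtain vs where vs: "H = cycle_edges vs" "distinct vs" "length vs \<ge> 3"
      "length vs = card (verts G)" "H \<subseteq> edges G"
    using assms(3) by (elim hamilton_cyclesE)
  have "\<chi> ` H \<subseteq> {1..r}"
    using assms(2) vs(5) unfolding colourings_def PiE_def Pi_def by blast
  then have "(\<Sum>c\<in>{1..r}. card {e \<in> H. \<chi> e = c}) = card H"
    using finite_cycle_edges[of vs] vs(1) by (intro sum_card_colour_classes) simp_all
  also have "card H = card (verts G)"
    using card_cycle_edges[OF vs(2,3)] vs(1,4) by simp
  finally have "(\<Sum>c\<in>{1..r}. ?k c) = ?n"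
    by (simp flip: of_nat_sum)
  moreover have "?k c - ?n / real r < 0" if "c \<in> {1..r}" for c
  proof -
    have "?k c - ?n / real r \<le> colour_bias r G \<chi> H"
      unfolding colour_bias_def using that by (intro Max_ge) auto
    then show ?thesis
      using neg by linarith
  qed
  then have "(\<Sum>c\<in>{1..r}. ?k c) < (\<Sum>c\<in>{1..r}. ?n / real r)"
    using assms(1) by (intro sum_strict_mono) auto
  ultimately show False
    using assms(1) by simp
qed

lemma max_colour_bias_nonneg:
  assumes "r \<ge> 1" "simple_graph G" "\<chi> \<in> colourings r G"
  shows "max_colour_bias r G \<chi> \<ge> 0"
  using colour_bias_nonneg[OF assms(1,3)] finite_hamilton_cycles[OF assms(2)]
  by (auto simp: max_colour_bias_def Max_ge_iff)

text \<open>Every colouring has maximal bias at least 0, and \<open>\<chi>\<close> attains 0, so the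
  minimum is 0. If there is no Hamilton cycle, \<open>\<chi>\<close> attains it through the default
  value in \<open>max_colour_bias\<close>.\<close>

lemma hamilton_bias_eq_0I:
  assumes "r \<ge> 1" "simple_graph G" "\<chi> \<in> colourings r G"
    and balanced: "\<And>H c. H \<in> hamilton_cycles G \<Longrightarrow> c \<in> {1..r} \<Longrightarrow>
           real (card {e \<in> H. \<chi> e = c}) = real (card (verts G)) / real r"
  shows "hamilton_bias r G = 0"
proof -
  have "colour_bias r G \<chi> H = 0" if "H \<in> hamilton_cycles G" for H
  proof -
    have "(\<lambda>c. real (card {e \<in> H. \<chi> e = c}) - real (card (verts G)) / real r) ` {1..r} = {0}"
      using balanced[OF that] assms(1) by force
    then show ?thesis
      by (simp add: colour_bias_def)
  qed
  then have "colour_bias r G \<chi> ` hamilton_cycles G = {0}" if "hamilton_cycles G \<noteq> {}"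
    using that by auto
  then have "max_colour_bias r G \<chi> = 0"
    by (simp add: max_colour_bias_def)
  moreover have "finite (colourings r G)"
    unfolding colourings_def using finite_edges[OF assms(2)] by (intro finite_PiE) auto
  ultimately show ?thesis
    unfolding hamilton_bias_def using max_colour_bias_nonneg[OF assms(1,2)] assms(3)
    by (intro Min_eqI) (auto intro!: image_eqI[of _ _ \<chi>])
qed

section \<open>The balanced colouring obtained from a large independent set\<close>

lemma hamilton_bias_eq_0_if_large_independent:
  assumes "r \<ge> 2" "simple_graph G" "card (verts G) = 2 * r * t"
    and J: "J \<subseteq> verts G" "card J = (r - 1) * t" "\<And>e. e \<in> edges G \<Longrightarrow> card (e \<inter> J) \<le> 1"
  shows "hamilton_bias r G = 0"
proof -
  have finJ: "finite J"
    using assms(2) J(1) by (auto simp: simple_graph_def intro: finite_subset)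
  obtain h where h: "bij_betw h J {0..<(r - 1) * t}"
    using ex_bij_betw_finite_nat[OF finJ] J(2) by auto
  \<comment> \<open>Numbering \<open>J\<close> by \<open>h\<close> and cutting the numbers into
    blocks of length \<open>t\<close> yields the \<open>r - 1\<close> classes; \<open>Suc\<close>
    makes their colours start at 1.\<close>
  define f where "f v = (if v \<in> J then Suc (h v div t) else r)" for v
  have f_J: "f v \<in> {1..<r}" if "v \<in> J" for v
  proof -
    have "h v < (r - 1) * t"
      using h that by (auto simp: bij_betw_def)
    then have "h v div t < r - 1"
      by (simp add: less_mult_imp_div_less)
    then show ?thesis
      using that by (simp add: f_def)
  qed
  then have f_range: "f v \<in> {1..r}" for v
    using assms(1) by (cases "v \<in> J") (force simp: f_def)+
  define S where "S c = {v \<in> J. f v = c}" for c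
  have card_S: "card (S c) = t" if "c \<in> {1..<r}" for c
  proof -
    \<comment> \<open>The blocks are the fibres of division by \<open>t\<close>. The bound on
      \<open>x\<close> rules out \<open>t = 0\<close>, where \<open>div\<close> would only return
      its default value.\<close>
    have t: "x div t = c - 1 \<longleftrightarrow> x \<in> {(c - 1) * t..<c * t}" if "x < (r - 1) * t" for x
    proof -
      have "t > 0"
        using that by (cases t) auto
      then show ?thesis
        using \<open>c \<in> {1..<r}\<close> div_nat_eqI[of t "c - 1" x] dividend_less_times_div[of t x]
          times_div_less_eq_dividend[of t x]
        by (cases c) (auto simp: algebra_simps)
    qed
    have sub: "{(c - 1) * t..<c * t} \<subseteq> {0..<(r - 1) * t}"
    proof
      fix x assume "x \<in> {(c - 1) * t..<c * t}"
      then have "x < c * t"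
        by simp
      also have "\<dots> \<le> (r - 1) * t"
        using that by (intro mult_right_mono) auto
      finally show "x \<in> {0..<(r - 1) * t}"
        by simp
    qed
    have "h ` S c = {x \<in> h ` J. x div t = c - 1}"
      using that by (auto simp: S_def f_def)
    also have "h ` J = {0..<(r - 1) * t}"
      using h by (simp add: bij_betw_def)
    also have "{x \<in> {0..<(r - 1) * t}. x div t = c - 1} = {(c - 1) * t..<c * t}"
    proof (rule set_eqI)
      fix x
      show "x \<in> {x \<in> {0..<(r - 1) * t}. x div t = c - 1} \<longleftrightarrow> x \<in> {(c - 1) * t..<c * t}"
        using t[of x] subsetD[OF sub, of x]
        by (cases "x \<in> {(c - 1) * t..<c * t}"; cases "x < (r - 1) * t") auto
    qed
    finally have "h ` S c = {(c - 1) * t..<c * t}" .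
    moreover have "card (h ` S c) = card (S c)"
      by (intro card_image inj_on_subset[OF bij_betw_imp_inj_on[OF h]]) (auto simp: S_def)
    ultimately show ?thesis
      using that by (cases c) auto
  qed
  \<comment> \<open>An edge has at most one end in \<open>J\<close>, and all other vertices have the largest colour.\<close>
  define \<chi> where "\<chi> = restrict (\<lambda>e. Min (f ` e)) (edges G)"
  have edge: "finite e" "e \<noteq> {}" if "e \<in> edges G" for e
  proof -
    have "card e = 2"
      using that assms(2) by (auto simp: simple_graph_def)
    then show "finite e" "e \<noteq> {}"
      by (auto intro: card_ge_0_finite)
  qed
  have \<chi>: "\<chi> \<in> colourings r G"
    unfolding \<chi>_def colourings_def
  proof (rule restrict_PiE_iff[THEN iffD2], intro ballI)
    fix e assume "e \<in> edges G"
    then have "Min (f ` e) \<in> f ` e"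
      using edge by (intro Min_in) auto
    then show "Min (f ` e) \<in> {1..r}"
      using f_range by auto
  qed
  \<comment> \<open>A colour below \<open>r\<close> can only come from an end in \<open>J\<close>.
    Conversely, if one end lies in \<open>S c\<close>, independence puts the other end outside
    \<open>J\<close>, where \<open>f\<close> is \<open>r\<close>, so the minimum is
    \<open>c\<close>.\<close>
  have \<chi>_iff: "\<chi> e = c \<longleftrightarrow> e \<inter> S c \<noteq> {}" if e: "e \<in> edges G" and c: "c \<in> {1..<r}" for e c
  proof
    assume "\<chi> e = c"
    then have "c \<in> f ` e"
      using Min_in[of "f ` e"] edge[OF e] e by (auto simp: \<chi>_def)
    then obtain v where "v \<in> e" "f v = c"
      by auto
    moreover from this have "v \<in> J"
      using c by (auto simp: f_def split: if_splits)
    ultimately show "e \<inter> S c \<noteq> {}"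
      by (auto simp: S_def)
  next
    assume "e \<inter> S c \<noteq> {}"
    then obtain v where v: "v \<in> e" "v \<in> J" "f v = c"
      by (auto simp: S_def)
    have "c \<le> f w" if "w \<in> e" for w
    proof (cases "w \<in> J")
      case True
      then have "card {v, w} \<le> card (e \<inter> J)"
        using v that finJ by (intro card_mono) auto
      then have "v = w"
        using J(3)[OF e] by (cases "v = w") auto
      then show ?thesis
        using v by simp
    next
      case False
      then show ?thesis
        using c by (simp add: f_def)
    qed
    then have "Min (f ` e) = c"
      using v edge[OF e] by (intro Min_eqI) auto
    then show "\<chi> e = c"
      using e by (simp add: \<chi>_def)
  qed
  show ?thesis
  proof (rule hamilton_bias_eq_0I[OF _ assms(2) \<chi>])
    show "r \<ge> 1"
      using assms(1) by simp
    fix H c assume H: "H \<in> hamilton_cycles G" and c: "c \<in> {1..r}"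
    obtain vs where vs: "H = cycle_edges vs" "distinct vs" "length vs \<ge> 3"
        "set vs = verts G" "length vs = card (verts G)" "H \<subseteq> edges G"
      using H by (elim hamilton_cyclesE)
    \<comment> \<open>Each class inherits independence from \<open>J\<close>, so the edges of its
      colour are counted by twice its size.\<close>
    have small: "card {e \<in> H. \<chi> e = c} = 2 * t" if "c \<in> {1..<r}" for c
    proof -
      have "{e \<in> H. \<chi> e = c} = {e \<in> cycle_edges vs. e \<inter> S c \<noteq> {}}"
        using \<chi>_iff[OF _ that] vs(1,6) by auto
      also have "card \<dots> = 2 * card (S c)"
      proof (rule card_cycle_edges_meeting_independent[OF vs(2,3)])
        show "S c \<subseteq> set vs"
          using J(1) vs(4) by (auto simp: S_def)
        fix e assume "e \<in> cycle_edges vs"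
        then have "card (e \<inter> J) \<le> 1"
          using J(3) vs(1,6) by auto
        moreover have "card (e \<inter> S c) \<le> card (e \<inter> J)"
          using finJ by (intro card_mono) (auto simp: S_def)
        ultimately show "card (e \<inter> S c) \<le> 1"
          by simp
      qed
      finally show ?thesis
        using card_S[OF that] by simp
    qed
    have "card {e \<in> H. \<chi> e = c} = 2 * t"
    proof (cases "c = r")
      case True
      \<comment> \<open>Colour \<open>r\<close> has no class of its own: it receives what the other
        \<open>r - 1\<close> colours, with \<open>2 * t\<close> edges each, leave of all
        \<open>2 * r * t\<close> edges.\<close>
      have "\<chi> ` H \<subseteq> {1..r}"
        using \<chi> vs(6) unfolding colourings_def PiE_def Pi_def by blast
      then have "(\<Sum>c\<in>{1..r}. card {e \<in> H. \<chi> e = c}) = card H"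
        using finite_cycle_edges[of vs] vs(1) by (intro sum_card_colour_classes) simp_all
      then have "2 * r * t = (\<Sum>c\<in>{1..r}. card {e \<in> H. \<chi> e = c})"
        using card_cycle_edges[OF vs(2,3)] vs(1,5) assms(3) by simp
      also have "{1..r} = insert r {1..<r}"
        using assms(1) by auto
      also have "(\<Sum>c\<in>insert r {1..<r}. card {e \<in> H. \<chi> e = c}) =
          card {e \<in> H. \<chi> e = r} + (r - 1) * (2 * t)"
        using small by simp
      finally show ?thesis
        using True assms(1) by (cases r) (auto simp: algebra_simps)
    next
      case False
      then show ?thesis
        using small c by auto
    qed
    then show "real (card {e \<in> H. \<chi> e = c}) = real (card (verts G)) / real r"
      using assms(1,3) by simp
  qed
qed

section \<open>The host graph and the independent set that survives the added edges\<close>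

definition complete_minus_clique :: "nat \<Rightarrow> nat \<Rightarrow> nat graph" where
  "complete_minus_clique n k =
     Graph {..<n} {e. e \<subseteq> {..<n} \<and> card e = 2 \<and> \<not> e \<subseteq> {..<k}}"

lemma simple_complete_minus_clique: "simple_graph (complete_minus_clique n k)"
  by (auto simp: simple_graph_def complete_minus_clique_def)

text \<open>A vertex below \<open>k\<close> is joined to the \<open>n - k\<close> vertices outside
  the removed clique. Any other vertex is joined to all \<open>n - 1\<close> others, which is enough
  since \<open>k\<close> is at least 1.\<close>

lemma min_degree_complete_minus_clique:
  assumes "1 \<le> k" "k \<le> n"
  shows "n - k \<le> min_degree (complete_minus_clique n k)"
proof -
  let ?G = "complete_minus_clique n k"
  have "n - k \<le> degree ?G v" if v: "v < n" for v
  proof -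
    define W where "W = (if v < k then {k..<n} else {..<n} - {v})"
    have "n - k \<le> card W"
      using assms v by (auto simp: W_def)
    also have "\<dots> = card ((\<lambda>u. {v, u}) ` W)"
      by (rule card_image[symmetric]) (auto simp: inj_on_def doubleton_eq_iff)
    also have "\<dots> \<le> degree ?G v"
      unfolding degree_def
    proof (rule card_mono)
      show "finite {e \<in> edges ?G. v \<in> e}"
        using finite_edges[OF simple_complete_minus_clique] by simp
      show "(\<lambda>u. {v, u}) ` W \<subseteq> {e \<in> edges ?G. v \<in> e}"
        using v by (auto simp: complete_minus_clique_def W_def card_insert_if split: if_splits)
    qed
    finally show ?thesis .
  qed
  moreover have verts: "verts ?G = {..<n}"
    by (simp add: complete_minus_clique_def)
  \<comment> \<open>The minimum in \<open>min_degree\<close> is specified only for a nonempty vertex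
    set.\<close>
  moreover have "{..<n} \<noteq> {}"
    using assms by (simp add: lessThan_empty_iff)
  ultimately show ?thesis
    unfolding min_degree_def using assms by (subst Min_ge_iff) (auto simp: verts)
qed

text \<open>The edges of \<open>F\<close> cover at most two vertices each, so at least
  \<open>s\<close> of the first \<open>k\<close> vertices are uncovered. On these, edges of
  \<open>F\<close> have no end, and every edge of the host graph has an end outside
  \<open>{..<k}\<close>.\<close>

lemma independent_after_union:
  assumes F: "simple_graph F" "verts F = {..<n}"
    and k: "k = s + 2 * card (edges F)" "k \<le> n"
  obtains J where "J \<subseteq> {..<n}" "card J = s"
    "\<And>e. e \<in> edges (graph_union (complete_minus_clique n k) F) \<Longrightarrow> card (e \<inter> J) \<le> 1"
proof -
  have "card (\<Union>(edges F)) \<le> (\<Sum>e\<in>edges F. card e)"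
    by (rule card_Union_le_sum_card)
  also have "\<dots> = (\<Sum>e\<in>edges F. 2)"
    using F(1) by (intro sum.cong) (auto simp: simple_graph_def)
  finally have "card (\<Union>(edges F)) \<le> 2 * card (edges F)"
    by simp
  moreover have "finite (\<Union>(edges F))"
    using F by (auto simp: simple_graph_def intro!: finite_subset[of _ "{..<n}"])
  ultimately have "s \<le> card ({..<k} - \<Union>(edges F))"
    using diff_card_le_card_Diff[of "\<Union>(edges F)" "{..<k}"] k(1) by simp
  then obtain J where J: "J \<subseteq> {..<k} - \<Union>(edges F)" "card J = s"
    using obtain_subset_with_card_n by metis
  show ?thesis
  proof
    show "J \<subseteq> {..<n}" "card J = s"
      using J k(2) by auto
    fix e assume "e \<in> edges (graph_union (complete_minus_clique n k) F)"
    then consider "e \<in> edges F" | "card e = 2" "\<not> e \<subseteq> {..<k}"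
      by (auto simp: graph_union_def complete_minus_clique_def)
    then show "card (e \<inter> J) \<le> 1"
    proof cases
      case 1
      then have "e \<inter> J = {}"
        using J(1) by blast
      then show ?thesis
        by simp
    next
      case 2
      then have "e \<inter> J \<subset> e" "finite e"
        using J(1) by (auto intro: card_ge_0_finite)
      then show ?thesis
        using psubset_card_mono[of e "e \<inter> J"] 2(1) by simp
    qed
  qed
qed

section \<open>Choice of the constants for large \<open>n\<close>\<close>

theorem proposition1p5:
  fixes r :: nat and \<alpha> :: real and m :: "nat \<Rightarrow> nat"
  assumes "r \<ge> 2"
    and "0 < \<alpha>" and "\<alpha> < (real r + 1) / (2 * real r)"
    and "(\<lambda>n. real (m n)) \<in> o(\<lambda>n. real n)"
  shows "\<forall>\<^sub>F n in sequentially. 2 * r dvd n \<longrightarrow>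
    (\<exists>G :: nat graph. simple_graph G \<and> card (verts G) = n \<and>
       real (min_degree G) \<ge> \<alpha> * real n \<and>
       (\<forall>F. simple_graph F \<and> verts F = verts G \<and> card (edges F) = m n \<longrightarrow>
          hamilton_bias r (graph_union G F) = 0))"
proof -
  \<comment> \<open>Half of the gap below the threshold: the independent set is enlarged by
    \<open>2 * m n\<close> vertices, which must cost at most the whole gap times
    \<open>n\<close>.\<close>
  define \<epsilon> where "\<epsilon> = ((real r + 1) / (2 * real r) - \<alpha>) / 2"
  have "\<epsilon> > 0"
    using assms(3) by (simp add: \<epsilon>_def)
  then have "\<forall>\<^sub>F n in sequentially. real (m n) \<le> \<epsilon> * real n"
    using landau_o.smallD[OF assms(4)] by simp
  moreover have "\<forall>\<^sub>F n in sequentially. n \<ge> (1::nat)"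
    by (rule eventually_ge_at_top)
  ultimately show ?thesis
  proof eventually_elim
    case (elim n)
    show ?case
    proof
      assume "2 * r dvd n"
      then obtain t where n: "n = 2 * r * t" ..
      \<comment> \<open>Excluding \<open>n = 0\<close> ensures that \<open>k\<close> is at least 1,
        as the degree bound requires.\<close>
      have t: "t \<ge> 1"
        using elim(2) n by (cases t) auto
      define k where "k = (r - 1) * t + 2 * m n"
      let ?G = "complete_minus_clique n k"
      \<comment> \<open>For \<open>n = 2 * r * t\<close> the threshold
        \<open>(r + 1) / (2 * r)\<close> times \<open>n\<close> is \<open>(r + 1) * t\<close>, which
        is the number of vertices outside an independent set of size
        \<open>(r - 1) * t\<close>.\<close>
      have "2 * (\<epsilon> * real n) = (real r + 1) * real t - \<alpha> * real n"
        using assms(1) by (simp add: \<epsilon>_def n field_simps)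
      then have small: "\<alpha> * real n \<le> (real r + 1) * real t - 2 * real (m n)"
        using elim(1) by linarith
      also have "\<dots> = real n - real k"
        using assms(1) by (cases r) (simp_all add: k_def n algebra_simps)
      finally have deg: "\<alpha> * real n \<le> real n - real k" .
      \<comment> \<open>Positivity of \<open>\<alpha>\<close> turns the degree estimate into
        \<open>k \<le> n\<close>, so the removed clique fits into the vertex set.\<close>
      have "0 \<le> \<alpha> * real n"
        using assms(2) by simp
      then have kn: "k \<le> n"
        using deg by linarith
      have "1 * 1 \<le> (r - 1) * t"
        using assms(1) t by (intro mult_le_mono) auto
      then have k1: "1 \<le> k"
        unfolding k_def by linarith
      have "hamilton_bias r (graph_union ?G F) = 0"
        if F: "simple_graph F" "verts F = verts ?G" "card (edges F) = m n" for F
      proof -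
        have V: "verts F = {..<n}" "verts (graph_union ?G F) = {..<n}"
          using F(2) by (auto simp: graph_union_def complete_minus_clique_def)
        have "k = (r - 1) * t + 2 * card (edges F)"
          by (simp add: k_def F(3))
        then obtain J where J: "J \<subseteq> {..<n}" "card J = (r - 1) * t"
          "\<And>e. e \<in> edges (graph_union ?G F) \<Longrightarrow> card (e \<inter> J) \<le> 1"
          using independent_after_union[OF F(1) V(1) _ kn] by metis
        have "simple_graph (graph_union ?G F)"
          using F(1,2) simple_complete_minus_clique[of n k]
          by (auto simp: simple_graph_def graph_union_def)
        then show ?thesis
          using hamilton_bias_eq_0_if_large_independent[OF assms(1) _ _ _ J(2,3)] J(1) V(2) n
          by (simp only: card_lessThan)
      qed
      moreover have "real (min_degree ?G) \<ge> \<alpha> * real n"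
        using min_degree_complete_minus_clique[OF k1 kn] deg by linarith
      moreover have "card (verts ?G) = n"
        by (simp add: complete_minus_clique_def)
      ultimately show "\<exists>G :: nat graph. simple_graph G \<and> card (verts G) = n \<and>
          real (min_degree G) \<ge> \<alpha> * real n \<and>
          (\<forall>F. simple_graph F \<and> verts F = verts G \<and> card (edges F) = m n \<longrightarrow>
            hamilton_bias r (graph_union G F) = 0)"
        using simple_complete_minus_clique by (intro exI[of _ ?G]) simp
    qed
  qed
qed

end
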